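(* Let $\Gamma\subseteq BN(C)$ be such that $C_\Gamma$ is denumerable, and let $\langle c_i\rangle_{i\in\mathbb{N}}$ be an injective enumeration of $C_\Gamma$. If $\Gamma$ is consistent and for every $i\in\mathbb{N}$ the set $\{q\in\mathbb{N}:Ac_ic_q\in\Gamma^{d}\}$ is finite, then $\Gamma$ has a Leibniz model.
   Context: Fix a set $C$ of constants with at least three elements. $BN(C)$ is the set of all strings (basic sentences) $Yab$ with $Y\in\{A,E,I,O\}$, $a,b\in C$ ($a=b$ allowed). Contradictories: $\widehat{Aab}=Oab$, $\widehat{Oab}=Aab$, $\widehat{Eab}=Iab$, $\widehat{Iab}=Eab$. The $d$-rules (for all $a,b,c\in C$): (A-Id) infer $Aaa$ from no premises; (Apc) from $Aab$ infer $Iba$; (Ec) from $Eab$ infer $Eba$; (Barbara) from $Aab,Abc$ infer $Aac$; (Celarent) from $Aab,Ebc$ infer $Eac$. $\Gamma\vdash^{d}\sigma$ means that there is a finite nonempty sequence of basic sentences ending in $\sigma$, each of whose terms is in $\Gamma$ or is the conclusion of a $d$-rule instance whose premises are earlier terms. $\Gamma^{d}=\{\sigma\in BN(C):\Gamma\vdash^{d}\sigma\}$. $\Gamma$ is inconsistent if $\Gamma\vdash^{d}\sigma$ and $\Gamma\vdash^{d}\widehat\sigma$ for some $\sigma\in BN(C)$, and consistent otherwise. $C_\Gamma$ is the set of $c\in C$ that occur in some element of $\Gamma$ having two distinct constants. Denumerable means countably infinite. Leibniz models: let $\mathbb{N}$ be the natural numbers including $0$, and $m\,\eta\,n$ mean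 that $m$ is a multiple of $n$ (so $0\,\eta\,n$ for all $n$). Let $B=\{(m,n)\in\mathbb{N}\times\mathbb{N}:\gcd(m,n)=1\}$ (with $\gcd(0,n)=n$), and let $(m_1,n_1)R(m_2,n_2)$ iff $m_1\,\eta\,m_2$ and $n_1\,\eta\,n_2$. A Leibniz model is given by a map $\mu:C\to B$; in it $Aab$ is true iff $\mu(a)R\mu(b)$; $Iab$ is true iff there is $x\in B$ with $xR\mu(a)$ and $xR\mu(b)$; $Eab$ is true iff $Iab$ is not; $Oab$ is true iff $Aab$ is not. It is a Leibniz model of $\Gamma$ if all elements of $\Gamma$ are true in it. *)

theory Defs
  imports Main "HOL-Library.Countable_Set"
begin

datatype (constants_of: 'c) sentence =
    SA 'c 'c
  | SE 'c 'c
  | SI 'c 'c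
  | SO 'c 'c

definition BN :: "'c set \<Rightarrow> 'c sentence set" where
  "BN C = {\<sigma>. constants_of \<sigma> \<subseteq> C}"

fun contradictory :: "'c sentence \<Rightarrow> 'c sentence" where
  "contradictory (SA a b) = SO a b"
| "contradictory (SO a b) = SA a b"
| "contradictory (SE a b) = SI a b"
| "contradictory (SI a b) = SE a b"

text \<open>\<open>d_rule C P \<sigma>\<close>: \<open>\<sigma>\<close> is the conclusion of a rule instance over \<open>C\<close> whose set of premises
  is \<open>P\<close>.\<close>

inductive d_rule :: "'c set \<Rightarrow> 'c sentence set \<Rightarrow> 'c sentence \<Rightarrow> bool" for C :: "'c set" where
  A_Id: "a \<in> C \<Longrightarrow> d_rule C {} (SA a a)"
| Apc: "\<lbrakk>a \<in> C; b \<in> C\<rbrakk> \<Longrightarrow> d_rule C {SA a b} (SI b a)"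
| Ec: "\<lbrakk>a \<in> C; b \<in> C\<rbrakk> \<Longrightarrow> d_rule C {SE a b} (SE b a)"
| Barbara: "\<lbrakk>a \<in> C; b \<in> C; c \<in> C\<rbrakk> \<Longrightarrow> d_rule C {SA a b, SA b c} (SA a c)"
| Celarent: "\<lbrakk>a \<in> C; b \<in> C; c \<in> C\<rbrakk> \<Longrightarrow> d_rule C {SA a b, SE b c} (SE a c)"

definition d_derivation :: "'c set \<Rightarrow> 'c sentence set \<Rightarrow> 'c sentence list \<Rightarrow> bool" where
  "d_derivation C \<Gamma> s \<longleftrightarrow> s \<noteq> [] \<and> set s \<subseteq> BN C \<and>
     (\<forall>i < length s. s ! i \<in> \<Gamma> \<or> (\<exists>P \<subseteq> set (take i s). d_rule C P (s ! i)))"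

definition d_derives :: "'c set \<Rightarrow> 'c sentence set \<Rightarrow> 'c sentence \<Rightarrow> bool" where
  "d_derives C \<Gamma> \<sigma> \<longleftrightarrow> (\<exists>s. d_derivation C \<Gamma> s \<and> last s = \<sigma>)"

definition d_closure :: "'c set \<Rightarrow> 'c sentence set \<Rightarrow> 'c sentence set" where
  "d_closure C \<Gamma> = {\<sigma> \<in> BN C. d_derives C \<Gamma> \<sigma>}"

definition inconsistent :: "'c set \<Rightarrow> 'c sentence set \<Rightarrow> bool" where
  "inconsistent C \<Gamma> \<longleftrightarrow>
     (\<exists>\<sigma> \<in> BN C. d_derives C \<Gamma> \<sigma> \<and> d_derives C \<Gamma> (contradictory \<sigma>))"

abbreviation consistent :: "'c set \<Rightarrow> 'c sentence set \<Rightarrow> bool" where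
  "consistent C \<Gamma> \<equiv> \<not> inconsistent C \<Gamma>"

definition proper_constants :: "'c set \<Rightarrow> 'c sentence set \<Rightarrow> 'c set" where
  "proper_constants C \<Gamma> =
     {c \<in> C. \<exists>\<sigma> \<in> \<Gamma>. c \<in> constants_of \<sigma> \<and>
        (\<exists>a \<in> constants_of \<sigma>. \<exists>b \<in> constants_of \<sigma>. a \<noteq> b)}"

definition denumerable :: "'a set \<Rightarrow> bool" where
  "denumerable X \<longleftrightarrow> countable X \<and> infinite X"

definition is_multiple_of :: "nat \<Rightarrow> nat \<Rightarrow> bool" (infix "\<eta>" 50) where
  "m \<eta> n \<longleftrightarrow> n dvd m"

definition leibniz_B :: "(nat \<times> nat) set" where
  "leibniz_B = {(m, n). gcd m n = 1}"

definition leibniz_R :: "nat \<times> nat \<Rightarrow> nat \<times> nat \<Rightarrow> bool" where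
  "leibniz_R p q \<longleftrightarrow> fst p \<eta> fst q \<and> snd p \<eta> snd q"

fun leibniz_true :: "('c \<Rightarrow> nat \<times> nat) \<Rightarrow> 'c sentence \<Rightarrow> bool" where
  "leibniz_true \<mu> (SA a b) \<longleftrightarrow> leibniz_R (\<mu> a) (\<mu> b)"
| "leibniz_true \<mu> (SI a b) \<longleftrightarrow> (\<exists>x \<in> leibniz_B. leibniz_R x (\<mu> a) \<and> leibniz_R x (\<mu> b))"
| "leibniz_true \<mu> (SE a b) \<longleftrightarrow> \<not> (\<exists>x \<in> leibniz_B. leibniz_R x (\<mu> a) \<and> leibniz_R x (\<mu> b))"
| "leibniz_true \<mu> (SO a b) \<longleftrightarrow> \<not> leibniz_R (\<mu> a) (\<mu> b)"

text \<open>Values of \<open>\<mu>\<close> outside \<open>C\<close> are irrelevant for \<open>\<Gamma> \<subseteq> BN C\<close>.\<close>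

definition leibniz_model :: "'c set \<Rightarrow> 'c sentence set \<Rightarrow> ('c \<Rightarrow> nat \<times> nat) \<Rightarrow> bool" where
  "leibniz_model C \<Gamma> \<mu> \<longleftrightarrow> \<mu> ` C \<subseteq> leibniz_B \<and> (\<forall>\<sigma> \<in> \<Gamma>. leibniz_true \<mu> \<sigma>)"

end

(* Let p_r be the r-th prime. Give c_i the first coordinate m_i = product of the p_r with
   A c_i c_r derivable, and the second coordinate n_i = product of the p_r for which some q >= r
   has A c_i c_q and E c_r c_q derivable. The bound r <= q makes n_i a finite product; it costs
   nothing because E is symmetric, so E c_i c_j puts p_(min i j) into both m_i and n_j or into
   both m_j and n_i. Conversely, a prime common to m_i and n_j yields E c_i c_j by Celarent and
   Ec. Constants outside C_Gamma occur in Gamma only in the valid sentences Aaa and Iaa. *)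
theory Submission
  imports Defs "HOL-Computational_Algebra.Primes" "HOL-Library.Infinite_Set"
begin

lemma leibniz_B_iff: "x \<in> leibniz_B \<longleftrightarrow> coprime (fst x) (snd x)"
  by (cases x) (simp add: leibniz_B_def coprime_iff_gcd_eq_1)

text \<open>Coprimality passes to divisors. Conversely, the coordinatewise product of
  \<open>p\<close> and \<open>q\<close> lies below both, and it is in \<open>leibniz_B\<close> once
  all four pairs are coprime.\<close>

lemma leibniz_R_common_lower_iff:
  "(\<exists>x\<in>leibniz_B. leibniz_R x p \<and> leibniz_R x q) \<longleftrightarrow>
     coprime (fst p) (snd p) \<and> coprime (fst p) (snd q) \<and>
     coprime (fst q) (snd p) \<and> coprime (fst q) (snd q)" (is "?L \<longleftrightarrow> ?R")
proof
  assume ?L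
  then obtain s t where "coprime s t"
    and "fst p dvd s" "fst q dvd s" "snd p dvd t" "snd q dvd t"
    by (auto simp: leibniz_B_iff leibniz_R_def is_multiple_of_def)
  then show ?R
    using coprime_divisors[of _ s _ t] by simp
next
  assume ?R
  then have "(fst p * fst q, snd p * snd q) \<in> leibniz_B"
    by (simp add: leibniz_B_iff)
  then show ?L
    by (rule bexI[rotated]) (simp add: leibniz_R_def is_multiple_of_def)
qed

lemma prod_primes_dvd_iff:
  fixes p :: "nat \<Rightarrow> nat"
  assumes "inj p" "\<And>i. prime (p i)" "finite X"
  shows "p i dvd prod p X \<longleftrightarrow> i \<in> X"
proof -
  have "p i dvd p j \<longleftrightarrow> i = j" for j
    using assms(1,2) primes_dvd_imp_eq[of "p i" "p j"] by (auto dest: injD)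
  then show ?thesis
    using assms(2,3) by (simp add: prime_dvd_prod_iff)
qed

text \<open>A shared index gives a common prime divisor; for disjoint index sets the primes on the
  two sides are distinct by injectivity.\<close>

lemma coprime_prod_primes_iff:
  fixes p :: "nat \<Rightarrow> nat"
  assumes p: "inj p" "\<And>i. prime (p i)" and fin: "finite X" "finite Y"
  shows "coprime (prod p X) (prod p Y) \<longleftrightarrow> X \<inter> Y = {}"
proof
  assume cop: "coprime (prod p X) (prod p Y)"
  have False if "i \<in> X" "i \<in> Y" for i
    using cop that p(2)[of i] coprime_common_divisor_nat[of "prod p X" "prod p Y" "p i"]
    by (simp add: prod_primes_dvd_iff[OF p] fin)
  then show "X \<inter> Y = {}" by blast
next
  assume "X \<inter> Y = {}"
  then show "coprime (prod p X) (prod p Y)"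
    using p by (intro prod_coprime_left prod_coprime_right primes_coprime) (auto simp: inj_def)
qed

text \<open>The number theory, detached from the calculus: \<open>A\<close> and \<open>E\<close>
  stand for derivability between enumerated constants. The assumptions mirror the rules, finiteness
  and consistency.\<close>

lemma leibniz_interpretation:
  fixes A E :: "nat \<Rightarrow> nat \<Rightarrow> bool"
  assumes refl: "\<And>i. A i i"
    and trans: "\<And>i j k. A i j \<Longrightarrow> A j k \<Longrightarrow> A i k"
    and fin: "\<And>i. finite {q. A i q}"
    and sym: "\<And>i j. E i j \<Longrightarrow> E j i"
    and down: "\<And>i j k. A i j \<Longrightarrow> E j k \<Longrightarrow> E i k"
    and irrefl: "\<And>i. \<not> E i i"
  obtains \<nu> where "\<And>i. \<nu> i \<in> leibniz_B"
    and "\<And>i j. leibniz_R (\<nu> i) (\<nu> j) \<longleftrightarrow> A i j"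
    and "\<And>i j. (\<exists>x\<in>leibniz_B. leibniz_R x (\<nu> i) \<and> leibniz_R x (\<nu> j)) \<longleftrightarrow> \<not> E i j"
proof -
  define p where "p = enumerate {q :: nat. prime q}"
  have p: "inj p" "prime (p i)" for i
    using primes_infinite enumerate_in_set[of "{q :: nat. prime q}" i]
      strict_mono_imp_inj_on[OF strict_mono_enumerate]
    by (auto simp: p_def)
  define M where "M i = {r. A i r}" for i
  define N where "N i = (\<Union>q\<in>{q. A i q}. {r. r \<le> q \<and> E r q})" for i
  have finM: "finite (M i)" and finN: "finite (N i)" for i
    using fin by (auto simp: M_def N_def)
  have E_if: "E i j" if "r \<in> M i" "r \<in> N j" for i j r
  proof -
    from that obtain q where "A i r" "A j q" "E r q"
      by (auto simp: M_def N_def)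
    then show ?thesis
      \<comment> \<open>\<open>E q r\<close> gives \<open>E j r\<close> through
        \<open>A j q\<close>; then \<open>E r j\<close> gives \<open>E i j\<close> through
        \<open>A i r\<close>.\<close>
      by (meson down sym)
  qed
  have E_iff: "M i \<inter> N j = {} \<and> M j \<inter> N i = {} \<longleftrightarrow> \<not> E i j" for i j
  proof
    assume disj: "M i \<inter> N j = {} \<and> M j \<inter> N i = {}"
    show "\<not> E i j"
    proof
      assume "E i j"
      \<comment> \<open>The smaller index is the witness: if \<open>i \<le> j\<close>, take
        \<open>q = j\<close> in \<open>N j\<close>, using \<open>A j j\<close>; otherwise exchange
        \<open>i\<close> and \<open>j\<close>.\<close>
      then have "i \<in> M i \<inter> N j \<or> j \<in> M j \<inter> N i"
        using refl[of i] refl[of j] sym[of i j] linear[of i j] unfolding M_def N_def by blast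
      with disj show False by blast
    qed
  qed (use E_if sym in blast)
  have disj: "M i \<inter> N i = {}" for i
    using E_iff irrefl by blast
  define \<nu> where "\<nu> i = (prod p (M i), prod p (N i))" for i
  show thesis
  proof
    show "\<nu> i \<in> leibniz_B" for i
      using disj by (simp add: leibniz_B_iff \<nu>_def coprime_prod_primes_iff[OF p] finM finN)
    show "leibniz_R (\<nu> i) (\<nu> j) \<longleftrightarrow> A i j" for i j
    proof
      assume "leibniz_R (\<nu> i) (\<nu> j)"
      \<comment> \<open>The prime \<open>p j\<close> detects \<open>A i j\<close>: it divides the
        first coordinate of \<open>\<nu> j\<close> and hence that of \<open>\<nu> i\<close>.\<close>
      moreover have "p j dvd prod p (M j)"
        using refl unfolding prod_primes_dvd_iff[OF p finM] by (simp add: M_def)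
      ultimately have "p j dvd prod p (M i)"
        by (auto simp: leibniz_R_def is_multiple_of_def \<nu>_def intro: dvd_trans)
      then show "A i j"
        unfolding prod_primes_dvd_iff[OF p finM] by (simp add: M_def)
    next
      assume "A i j"
      \<comment> \<open>The bound \<open>r \<le> q\<close> depends on the intermediate
        \<open>q\<close> and not on \<open>i\<close> or \<open>j\<close>, so \<open>N\<close> is
        monotone along \<open>A\<close> just as \<open>M\<close> is.\<close>
      then have "M j \<subseteq> M i" "N j \<subseteq> N i"
        using trans by (auto simp: M_def N_def)
      then show "leibniz_R (\<nu> i) (\<nu> j)"
        by (simp add: leibniz_R_def is_multiple_of_def \<nu>_def prod_dvd_prod_subset finM finN)
    qed
    show "(\<exists>x\<in>leibniz_B. leibniz_R x (\<nu> i) \<and> leibniz_R x (\<nu> j)) \<longleftrightarrow> \<not> E i j" for i j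
      using E_iff[of i j] disj
      by (auto simp: leibniz_R_common_lower_iff \<nu>_def coprime_prod_primes_iff[OF p] finM finN)
  qed
qed

lemma d_derivation_append:
  assumes "d_derivation C \<Gamma> s" "d_derivation C \<Gamma> t"
  shows "d_derivation C \<Gamma> (s @ t)"
  unfolding d_derivation_def
proof (intro conjI allI impI)
  fix i assume i: "i < length (s @ t)"
  show "(s @ t) ! i \<in> \<Gamma> \<or> (\<exists>P\<subseteq>set (take i (s @ t)). d_rule C P ((s @ t) ! i))"
  proof (cases "i < length s")
    case True
    then show ?thesis
      using assms(1) by (simp add: d_derivation_def nth_append)
  next
    case False
    then have "t ! (i - length s) \<in> \<Gamma> \<or>
        (\<exists>P\<subseteq>set (take (i - length s) t). d_rule C P (t ! (i - length s)))"
      using assms(2) i by (simp add: d_derivation_def)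
    with False show ?thesis
      by (auto simp: nth_append)
  qed
qed (use assms in \<open>auto simp: d_derivation_def\<close>)

lemma d_derivation_snoc:
  assumes "s = [] \<or> d_derivation C \<Gamma> s" "\<sigma> \<in> BN C"
    and "\<sigma> \<in> \<Gamma> \<or> (\<exists>P\<subseteq>set s. d_rule C P \<sigma>)"
  shows "d_derivation C \<Gamma> (s @ [\<sigma>])"
  unfolding d_derivation_def
proof (intro conjI allI impI)
  fix i assume i: "i < length (s @ [\<sigma>])"
  show "(s @ [\<sigma>]) ! i \<in> \<Gamma> \<or>
    (\<exists>P\<subseteq>set (take i (s @ [\<sigma>])). d_rule C P ((s @ [\<sigma>]) ! i))"
  proof (cases "i < length s")
    case True
    with assms(1) have "d_derivation C \<Gamma> s"
      by auto
    with True show ?thesis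
      by (simp add: d_derivation_def nth_append)
  next
    case False
    with i have "i = length s"
      by simp
    then show ?thesis
      using assms(3) by simp
  qed
qed (use assms in \<open>auto simp: d_derivation_def\<close>)

lemma d_derives_assm:
  assumes "\<sigma> \<in> \<Gamma>" "\<Gamma> \<subseteq> BN C"
  shows "d_derives C \<Gamma> \<sigma>"
  unfolding d_derives_def
  using d_derivation_snoc[of "[]" C \<Gamma> \<sigma>] assms by (intro exI[of _ "[\<sigma>]"]) auto

text \<open>Derivations of the finitely many premises are concatenated and the conclusion is
  appended. This closure property lets the main argument avoid derivations as lists.\<close>

lemma d_derives_rule:
  assumes rule: "d_rule C P \<sigma>" and prems: "\<And>\<tau>. \<tau> \<in> P \<Longrightarrow> d_derives C \<Gamma> \<tau>"
  shows "d_derives C \<Gamma> \<sigma>"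
proof -
  have "finite P" "\<sigma> \<in> BN C"
    using rule by (auto elim!: d_rule.cases simp: BN_def)
  have "\<exists>s. (s = [] \<or> d_derivation C \<Gamma> s) \<and> P \<subseteq> set s"
    using \<open>finite P\<close> prems
  proof (induction P)
    case (insert \<tau> P)
    then obtain s where s: "s = [] \<or> d_derivation C \<Gamma> s" "P \<subseteq> set s"
      by auto
    from insert.prems obtain t where t: "d_derivation C \<Gamma> t" "last t = \<tau>"
      by (auto simp: d_derives_def)
    then have "\<tau> \<in> set t"
      using last_in_set by (force simp: d_derivation_def)
    moreover have "d_derivation C \<Gamma> (s @ t)"
      using s(1) t(1) d_derivation_append by auto
    ultimately show ?case
      using s(2) by (intro exI[of _ "s @ t"]) auto
  qed auto
  then obtain s where "s = [] \<or> d_derivation C \<Gamma> s" "P \<subseteq> set s"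
    by blast
  then have "d_derivation C \<Gamma> (s @ [\<sigma>])"
    using rule \<open>\<sigma> \<in> BN C\<close> by (blast intro: d_derivation_snoc)
  then show ?thesis
    by (auto simp: d_derives_def)
qed

theorem theorem2p16:
  fixes C :: "'c set" and \<Gamma> :: "'c sentence set" and c :: "nat \<Rightarrow> 'c"
  assumes "\<exists>x\<in>C. \<exists>y\<in>C. \<exists>z\<in>C. x \<noteq> y \<and> y \<noteq> z \<and> x \<noteq> z"
    and "\<Gamma> \<subseteq> BN C"
    and "denumerable (proper_constants C \<Gamma>)"
    and "bij_betw c UNIV (proper_constants C \<Gamma>)"
    and "consistent C \<Gamma>"
    and "\<And>i. finite {q. SA (c i) (c q) \<in> d_closure C \<Gamma>}"
  shows "\<exists>\<mu>. leibniz_model C \<Gamma> \<mu>"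
proof -
  let ?D = "d_derives C \<Gamma>"
  have inj: "inj c" and range: "range c = proper_constants C \<Gamma>"
    using assms(4) by (auto simp: bij_betw_def)
  then have cC: "c i \<in> C" for i
    using rangeI[of c i] by (simp add: proper_constants_def)
  have A_refl: "?D (SA a a)" if "a \<in> C" for a
    by (rule d_derives_rule[OF A_Id]) (use that in auto)
  have I_conv: "?D (SI b a)" if "?D (SA a b)" "a \<in> C" "b \<in> C" for a b
    by (rule d_derives_rule[OF Apc]) (use that in auto)
  have E_sym: "?D (SE b a)" if "?D (SE a b)" "a \<in> C" "b \<in> C" for a b
    by (rule d_derives_rule[OF Ec]) (use that in auto)
  have A_trans: "?D (SA a d)" if "?D (SA a b)" "?D (SA b d)" "a \<in> C" "b \<in> C" "d \<in> C" for a b d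
    by (rule d_derives_rule[OF Barbara[of a C b d]]) (use that in auto)
  have E_down: "?D (SE a d)" if "?D (SA a b)" "?D (SE b d)" "a \<in> C" "b \<in> C" "d \<in> C" for a b d
    by (rule d_derives_rule[OF Celarent[of a C b d]]) (use that in auto)
  have cons: "\<not> ?D (contradictory \<sigma>)" if "?D \<sigma>" "\<sigma> \<in> BN C" for \<sigma>
    using assms(5) that by (auto simp: inconsistent_def)
  have not_O: "\<not> ?D (SO a b)" if "?D (SA a b)" "a \<in> C" "b \<in> C" for a b
    using cons[OF that(1)] that by (simp add: BN_def)
  have not_E: "\<not> ?D (SE a b)" if "?D (SI a b)" "a \<in> C" "b \<in> C" for a b
    using cons[OF that(1)] that by (simp add: BN_def)
  \<comment> \<open>(A-Id) and (Apc) yield \<open>SI a a\<close>, the contradictory of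
    \<open>SE a a\<close>.\<close>
  have E_irrefl: "\<not> ?D (SE a a)" if "a \<in> C" for a
    using that by (intro not_E I_conv A_refl)
  have A_fin: "finite {q. ?D (SA (c i) (c q))}" for i
    using assms(6)[of i] cC by (simp add: d_closure_def BN_def)
  obtain \<nu> where \<nu>B: "\<And>i. \<nu> i \<in> leibniz_B"
    and \<nu>A: "\<And>i j. leibniz_R (\<nu> i) (\<nu> j) \<longleftrightarrow> ?D (SA (c i) (c j))"
    and \<nu>E: "\<And>i j. (\<exists>x\<in>leibniz_B. leibniz_R x (\<nu> i) \<and> leibniz_R x (\<nu> j)) \<longleftrightarrow>
      \<not> ?D (SE (c i) (c j))"
    by (rule leibniz_interpretation[of "\<lambda>i j. ?D (SA (c i) (c j))" "\<lambda>i j. ?D (SE (c i) (c j))",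
          OF A_refl[OF cC] A_trans[OF _ _ cC cC cC] A_fin E_sym[OF _ cC cC]
            E_down[OF _ _ cC cC cC] E_irrefl[OF cC]]) (assumption | rule that)+
  \<comment> \<open>Outside the range of \<open>c\<close> any element of \<open>leibniz_B\<close>
    would serve as the default.\<close>
  define \<mu> where "\<mu> a = (if a \<in> range c then \<nu> (inv c a) else (1, 1))" for a
  have \<mu>c: "\<mu> (c i) = \<nu> i" for i
    using inj by (simp add: \<mu>_def)
  have true_c: "leibniz_true \<mu> (SA (c i) (c j)) \<longleftrightarrow> ?D (SA (c i) (c j))"
    "leibniz_true \<mu> (SO (c i) (c j)) \<longleftrightarrow> \<not> ?D (SA (c i) (c j))"
    "leibniz_true \<mu> (SE (c i) (c j)) \<longleftrightarrow> ?D (SE (c i) (c j))"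
    "leibniz_true \<mu> (SI (c i) (c j)) \<longleftrightarrow> \<not> ?D (SE (c i) (c j))" for i j
    by (simp_all only: leibniz_true.simps \<mu>c \<nu>A \<nu>E not_not)
  have \<mu>B: "\<mu> a \<in> leibniz_B" for a
    using \<nu>B by (simp add: \<mu>_def leibniz_B_iff)
  have R_refl: "leibniz_R (\<mu> a) (\<mu> a)" for a
    by (simp add: leibniz_R_def is_multiple_of_def)
  have I_refl: "\<exists>x\<in>leibniz_B. leibniz_R x (\<mu> a)" for a
    using \<mu>B R_refl by blast
  have true: "leibniz_true \<mu> \<sigma>" if \<sigma>: "\<sigma> \<in> \<Gamma>" for \<sigma>
  proof -
    have \<sigma>C: "constants_of \<sigma> \<subseteq> C" and D\<sigma>: "?D \<sigma>"
      using \<sigma> assms(2) d_derives_assm by (auto simp: BN_def)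
    show ?thesis
    proof (cases "\<exists>a\<in>constants_of \<sigma>. \<exists>b\<in>constants_of \<sigma>. a \<noteq> b")
      case True
      then have "constants_of \<sigma> \<subseteq> range c"
        using \<sigma> \<sigma>C range by (auto simp: proper_constants_def)
      \<comment> \<open>For \<open>SA\<close> and \<open>SE\<close>, truth coincides with
        derivability. A derivable \<open>SO\<close> or \<open>SI\<close> is true since consistency
        excludes deriving its contradictory.\<close>
      with D\<sigma> show ?thesis
        using not_O[OF _ cC cC] not_E[OF _ cC cC] true_c
        by (cases \<sigma>) (auto simp del: leibniz_true.simps)
    next
      case False
      \<comment> \<open>Here \<open>\<sigma>\<close> has a single constant \<open>a\<close>.
        Consistency excludes \<open>SE a a\<close> and \<open>SO a a\<close>; the other two forms
        hold by reflexivity, with \<open>\<mu> a\<close> as the witness for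
        \<open>SI a a\<close>.\<close>
      then show ?thesis
        using \<sigma>C D\<sigma> A_refl not_O E_irrefl R_refl I_refl by (cases \<sigma>) auto
    qed
  qed
  show ?thesis
    using \<mu>B true by (auto simp: leibniz_model_def)
qed

end
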